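(* Let $p$ be a prime, let $q \in \mathbb{C}_p$ with $|1-q|_p<1$, and let $x \in \mathbb{Z}_p$. Then for every $n \in \mathbb{Z}_+=\mathbb{N}\cup\{0\}$, $$\int_{\mathbb{Z}_p}[1-x+x_1]_{\frac{1}{q}}^n \, d\mu_{\frac{1}{q}}(x_1)= (-1)^n q^n \int_{\mathbb{Z}_p} [x+x_1]_q^n \, d\mu_q (x_1).$$
   Context: $\mathbb{C}_p$ is the completion of an algebraic closure of $\mathbb{Q}_p$ and $|\cdot|_p$ its normalized absolute value with $|p|_p=1/p$. For $q\in\mathbb{C}_p$ with $|1-q|_p<1$ and $y\in\mathbb{Z}_p$, $[y]_q=\frac{1-q^y}{1-q}$; $[y]_{1/q}$ is the same with $q$ replaced by $q^{-1}$. For a uniformly differentiable function $f:\mathbb{Z}_p\to\mathbb{C}_p$, the $p$-adic $q$-integral is $\int_{\mathbb{Z}_p} f(y)\,d\mu_q(y)=\lim_{N\to\infty}\frac{1}{[p^N]_q}\sum_{y=0}^{p^N-1} f(y)q^y$, and $\int_{\mathbb{Z}_p} f(y)\,d\mu_{1/q}(y)$ is defined in the same way with $q$ replaced by $q^{-1}$. *)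

theory Defs
  imports "HOL-Computational_Algebra.Polynomial" "HOL-Computational_Algebra.Primes"
    "HOL-Analysis.Elementary_Metric_Spaces"
begin

text \<open>
  The field of p-adic complex numbers is represented by a complete metric space that is a field,
  constrained by the predicate \<open>is_Cp\<close> below. It is not a normed space over the reals, so
  \<^const>\<open>norm\<close> is not available; the absolute value is the distance to 0, and the
  metric is required to be the one induced by it.
  The sets \<open>Qp\<close> and \<open>Zp\<close> are the copies of the p-adic numbers and the p-adic integers
  inside this field; they depend on p through the metric only.
\<close>

definition pabs :: "'a :: {field_char_0, complete_space} \<Rightarrow> real" where
  "pabs a = dist a 0"

definition Qp :: "'a :: {field_char_0, complete_space} set" where
  "Qp = closure (range of_rat)"

definition Zp :: "'a :: {field_char_0, complete_space} set" where
  "Zp = {y \<in> Qp. pabs y \<le> 1}"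

definition Qp_bar :: "'a :: {field_char_0, complete_space} set" where
  "Qp_bar = {z. \<exists>P. P \<noteq> 0 \<and> (\<forall>i. coeff P i \<in> Qp) \<and> poly P z = 0}"

text \<open>
  \<open>is_Cp p TYPE('a)\<close>: the type is a complete field whose metric comes from a non-archimedean
  absolute value with |p| = 1/p (positive definiteness comes from the metric), in which the elements
  algebraic over \<open>Qp\<close> form an algebraically closed, dense subfield. That is, it is the
  completion of an algebraic closure of the p-adic numbers.
\<close>

definition is_Cp :: "nat \<Rightarrow> 'a :: {field_char_0, complete_space} itself \<Rightarrow> bool" where
  "is_Cp p _ \<longleftrightarrow>
     (\<forall>a b :: 'a. dist a b = pabs (a - b)) \<and>
     (\<forall>a b :: 'a. pabs (a * b) = pabs a * pabs b) \<and>
     (\<forall>a b :: 'a. pabs (a + b) \<le> max (pabs a) (pabs b)) \<and>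
     pabs (of_nat p :: 'a) = 1 / real p \<and>
     (\<forall>P :: 'a poly. degree P > 0 \<and> (\<forall>i. coeff P i \<in> Qp_bar) \<longrightarrow>
        (\<exists>z \<in> Qp_bar. poly P z = 0)) \<and>
     closure (Qp_bar :: 'a set) = UNIV"

text \<open>
  For |1 - q| < 1 and y in \<open>Zp\<close>, the power \<open>q\<^sup>y\<close> is the continuous extension of the powers
  with natural exponents: the limit of \<open>q ^ k\<close> as the natural number k tends p-adically to y.
\<close>

definition qpow :: "'a :: {field_char_0, complete_space} \<Rightarrow> 'a \<Rightarrow> 'a" where
  "qpow q y = Lim (filtercomap of_nat (nhds y)) (\<lambda>k :: nat. q ^ k)"

text \<open>At q = 1 the quotient is 0/0 and is read as its limiting value y.\<close>

definition qnum :: "'a :: {field_char_0, complete_space} \<Rightarrow> 'a \<Rightarrow> 'a" where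
  "qnum q y = (if q = 1 then y else (1 - qpow q y) / (1 - q))"

text \<open>
  If q is a root of unity of p-power order other than 1, then \<open>[p\<^sup>N]\<^sub>q\<close> vanishes for large N and
  the integral has no mathematical meaning; it is then 0 because division by 0 yields 0.
\<close>

definition q_integral ::
    "nat \<Rightarrow> 'a :: {field_char_0, complete_space} \<Rightarrow> ('a \<Rightarrow> 'a) \<Rightarrow> 'a" where
  "q_integral p q f =
     lim (\<lambda>N. 1 / qnum q (of_nat (p ^ N)) * (\<Sum>y = 0..<p ^ N. f (of_nat y) * q ^ y))"

end

theory Submission
  imports Defs "HOL-Number_Theory.Cong" "HOL-Analysis.Elementary_Normed_Spaces"
begin

text \<open>
  Let \<open>I\<^sub>N(x)\<close> be the approximation of the right-hand integral with \<open>P = p\<^sup>N\<close> terms. Substituting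
  \<open>P - 1 - y\<close> for \<open>y\<close> and using \<open>[-z]\<^bsub>1/q\<^esub> = -q [z]\<^sub>q\<close> turns the approximation of the left-hand
  integral into \<open>(-q)\<^sup>n I\<^sub>N(x - P)\<close>. For \<open>c = -1\<close> or \<open>c \<ge> 0\<close>, the difference \<open>I\<^sub>N(x + c P) - I\<^sub>N(x)\<close>
  tends to 0: dividing by \<open>[P]\<^sub>q\<close> leaves sums of continuous functions over \<open>0, \<dots>, P - 1\<close>, and these
  are p-adically small because \<open>\<Sum>\<^bsub>y<pP\<^esub> h y\<close> is close to \<open>p \<Sum>\<^bsub>y<P\<^esub> h y\<close>.
  The case \<open>c = -1\<close> compares the two integrals. The cases \<open>0 \<le> c < p\<close> give \<open>I\<^bsub>N+1\<^esub>(x) - I\<^sub>N(x) \<longlonglongrightarrow> 0\<close>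
  unless \<open>[P]\<^sub>q\<close> vanishes for large \<open>N\<close>, where \<open>I\<^sub>N(x)\<close> is eventually 0. Either way \<open>I\<^sub>N(x)\<close>
  converges, which is needed because the value of \<open>lim\<close> on a divergent sequence is arbitrary and
  would not commute with the factor \<open>(-q)\<^sup>n\<close>.
\<close>

section \<open>The absolute value on C_p and on the integers\<close>

locale Cp =
  fixes p :: nat and T :: "'a :: {field_char_0, complete_space} itself"
  assumes prime: "prime p" and Cp: "is_Cp p T"
begin

lemma dist_eq: "dist a b = pabs (a - b)" for a b :: 'a
  using Cp unfolding is_Cp_def by blast

lemma pabs_mult: "pabs (a * b) = pabs a * pabs b" for a b :: 'a
  using Cp unfolding is_Cp_def by blast

lemma pabs_add: "pabs (a + b) \<le> max (pabs a) (pabs b)" for a b :: 'a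
  using Cp unfolding is_Cp_def by blast

lemma pabs_p: "pabs (of_nat p :: 'a) = 1 / real p"
  using Cp unfolding is_Cp_def by blast

lemma p_gt_1: "p > 1"
  using prime prime_gt_1_nat by blast

lemma pabs_nonneg [simp]: "0 \<le> pabs (a :: 'a)"
  by (simp add: pabs_def)

lemma pabs_0 [simp]: "pabs (0 :: 'a) = 0"
  by (simp add: pabs_def)

lemma pabs_eq_0 [simp]: "pabs (a :: 'a) = 0 \<longleftrightarrow> a = 0"
  by (simp add: pabs_def)

lemma pabs_pos [simp]: "0 < pabs (a :: 'a) \<longleftrightarrow> a \<noteq> 0"
  by (simp add: pabs_def)

lemma pabs_1 [simp]: "pabs (1 :: 'a) = 1"
  using pabs_mult[of 1 1] by simp

lemma pabs_power: "pabs (a ^ n) = pabs a ^ n" for a :: 'a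
  by (induction n) (auto simp: pabs_mult)

lemma pabs_minus [simp]: "pabs (- a) = pabs a" for a :: 'a
  by (metis dist_commute dist_eq diff_0 diff_0_right)

lemma pabs_minus_commute: "pabs (a - b) = pabs (b - a)" for a b :: 'a
  by (metis dist_commute dist_eq)

lemma pabs_divide: "pabs (a / b) = pabs a / pabs b" for a b :: 'a
proof (cases "b = 0")
  case False
  then have "pabs (a / b) * pabs b = pabs a"
    by (simp flip: pabs_mult)
  with False show ?thesis by (simp add: field_simps)
qed simp

lemma pabs_add_le: "pabs a \<le> C \<Longrightarrow> pabs b \<le> C \<Longrightarrow> pabs (a + b) \<le> C" for a b :: 'a
  using pabs_add[of a b] by linarith

lemma pabs_diff_le: "pabs a \<le> C \<Longrightarrow> pabs b \<le> C \<Longrightarrow> pabs (a - b) \<le> C" for a b :: 'a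
  using pabs_add_le[of a C "- b"] by simp

lemma pabs_add_triangle: "pabs (a + b) \<le> pabs a + pabs b" for a b :: 'a
  using pabs_add[of a b] pabs_nonneg[of a] pabs_nonneg[of b] by linarith

lemma pabs_sum_le:
  fixes f :: "'b \<Rightarrow> 'a"
  assumes "\<And>i. i \<in> A \<Longrightarrow> pabs (f i) \<le> C" "0 \<le> C"
  shows "pabs (sum f A) \<le> C"
  using assms by (induction A rule: infinite_finite_induct) (auto intro: pabs_add_le)

lemma pabs_of_nat_le [simp]: "pabs (of_nat m :: 'a) \<le> 1"
  by (induction m) (auto intro: pabs_add_le)

lemma pabs_of_int_le [simp]: "pabs (of_int m :: 'a) \<le> 1"
  by (cases m rule: int_cases2) auto

text \<open>In a Bezout relation u m + v p = 1 the term v p has absolute value below 1, so the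
  ultrametric inequality forces |u m| to be at least 1, while |u| is at most 1.\<close>

lemma pabs_of_int_coprime:
  assumes "coprime m (int p)"
  shows "pabs (of_int m :: 'a) = 1"
proof -
  obtain u v where uv: "u * m + v * int p = 1"
    using assms bezout_int[of m "int p"] by auto
  have "1 = pabs (of_int u * of_int m + of_int v * of_nat p :: 'a)"
    by (metis of_int_1 of_int_add of_int_mult of_int_of_nat_eq pabs_1 uv)
  also have "\<dots> \<le> max (pabs (of_int u * of_int m :: 'a)) (pabs (of_int v * of_nat p :: 'a))"
    by (rule pabs_add)
  finally have "1 \<le> pabs (of_int u * of_int m :: 'a) \<or> 1 \<le> pabs (of_int v * of_nat p :: 'a)"
    by linarith
  moreover have "pabs (of_int v * of_nat p :: 'a) < 1"
  proof -
    have "pabs (of_int v :: 'a) * (1 / real p) \<le> 1 * (1 / real p)"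
      by (intro mult_right_mono) auto
    also have "\<dots> < 1" using p_gt_1 by simp
    finally show ?thesis by (simp add: pabs_mult pabs_p)
  qed
  moreover have "pabs (of_int u * of_int m :: 'a) \<le> 1 * pabs (of_int m :: 'a)"
    unfolding pabs_mult by (intro mult_right_mono) auto
  ultimately have "1 \<le> pabs (of_int m :: 'a)" by linarith
  with pabs_of_int_le[of m] show ?thesis by linarith
qed

lemma coprime_p: "\<not> int p dvd m \<Longrightarrow> coprime m (int p)"
  using prime_imp_coprime[of "int p" m] prime by (simp add: coprime_commute)

text \<open>Splitting off the exact power p^e leaves a cofactor of absolute value 1, so |d| =
  p^(-e). This turns closeness of two natural numbers into a congruence modulo p^N.\<close>

lemma p_power_dvd:
  assumes "pabs (of_int d :: 'a) \<le> (1 / real p) ^ N"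
  shows "int p ^ N dvd d"
proof (cases "d = 0")
  case False
  have "\<not> is_unit (int p)" using p_gt_1 by simp
  with False obtain u where u: "d = int p ^ multiplicity (int p) d * u" "\<not> int p dvd u"
    by (rule multiplicity_decompose')
  define e where "e = multiplicity (int p) d"
  have "coprime u (int p)"
    using u(2) by (rule coprime_p)
  then have "pabs (of_int d :: 'a) = (1 / real p) ^ e"
    by (subst u(1)) (simp add: pabs_mult pabs_power pabs_p pabs_of_int_coprime flip: e_def)
  with assms have "(1 / real p) ^ e \<le> (1 / real p) ^ N" by simp
  then have "N \<le> e" using p_gt_1 by (simp add: power_decreasing_iff)
  then show ?thesis using u(1) by (metis e_def dvd_mult2 le_imp_power_dvd)
qed simp

section \<open>Limits and completeness in the ultrametric\<close>

lemma tendsto_iff_pabs: "(f \<longlonglongrightarrow> l) \<longleftrightarrow> (\<lambda>i. pabs (f i - l)) \<longlonglongrightarrow> 0" for l :: 'a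
  by (simp add: tendsto_dist_iff[of f l] dist_eq)

lemma tendsto_addI:
  fixes f g :: "nat \<Rightarrow> 'a"
  assumes "f \<longlonglongrightarrow> a" "g \<longlonglongrightarrow> b"
  shows "(\<lambda>i. f i + g i) \<longlonglongrightarrow> a + b"
  unfolding tendsto_iff_pabs
proof (rule Lim_null_comparison)
  show "\<forall>\<^sub>F i in sequentially.
          norm (pabs (f i + g i - (a + b))) \<le> pabs (f i - a) + pabs (g i - b)"
    using pabs_add_triangle[of "f _ - a" "g _ - b"] by (simp add: algebra_simps)
  show "(\<lambda>i. pabs (f i - a) + pabs (g i - b)) \<longlonglongrightarrow> 0"
    using tendsto_add[OF assms[unfolded tendsto_iff_pabs]] by simp
qed

lemma tendsto_multI:
  fixes f g :: "nat \<Rightarrow> 'a"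
  assumes "f \<longlonglongrightarrow> a" "g \<longlonglongrightarrow> b"
  shows "(\<lambda>i. f i * g i) \<longlonglongrightarrow> a * b"
  unfolding tendsto_iff_pabs
proof (rule Lim_null_comparison)
  let ?u = "\<lambda>i. pabs (f i - a)" and ?v = "\<lambda>i. pabs (g i - b)"
  have "pabs (f i * g i - a * b) \<le> ?u i * ?v i + pabs a * ?v i + ?u i * pabs b" for i
  proof -
    have "f i * g i - a * b = ((f i - a) * (g i - b) + a * (g i - b)) + (f i - a) * b"
      by (simp add: algebra_simps)
    then show ?thesis
      using pabs_add_triangle[of "(f i - a) * (g i - b) + a * (g i - b)" "(f i - a) * b"]
        pabs_add_triangle[of "(f i - a) * (g i - b)" "a * (g i - b)"]
      by (simp add: pabs_mult)
  qed
  then show "\<forall>\<^sub>F i in sequentially. norm (pabs (f i * g i - a * b))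
      \<le> ?u i * ?v i + pabs a * ?v i + ?u i * pabs b" by simp
  have "(\<lambda>i. ?u i * ?v i + pabs a * ?v i + ?u i * pabs b) \<longlonglongrightarrow> 0 * 0 + pabs a * 0 + 0 * pabs b"
    using assms unfolding tendsto_iff_pabs by (intro tendsto_intros)
  then show "(\<lambda>i. ?u i * ?v i + pabs a * ?v i + ?u i * pabs b) \<longlonglongrightarrow> 0" by simp
qed

lemma pabs_le_limit:
  assumes "f \<longlonglongrightarrow> (l :: 'a)" "\<And>i. pabs (f i) \<le> C"
  shows "pabs l \<le> C"
proof (rule LIMSEQ_le_const2)
  show "(\<lambda>i. pabs (f i)) \<longlonglongrightarrow> pabs l"
    unfolding pabs_def by (intro tendsto_intros assms)
  show "\<exists>N. \<forall>n\<ge>N. pabs (f n) \<le> C" using assms by blast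
qed

text \<open>In an ultrametric the errors of successive steps do not add up: a telescoping sum is
  bounded by its largest term, so the sequence is Cauchy.\<close>

lemma convergent_of_diff_tendsto_0:
  fixes f :: "nat \<Rightarrow> 'a"
  assumes "(\<lambda>N. pabs (f (Suc N) - f N)) \<longlonglongrightarrow> 0"
  shows "convergent f"
proof -
  have "Cauchy f"
  proof (rule metric_CauchyI)
    fix e :: real assume "e > 0"
    then obtain M where "\<And>N. N \<ge> M \<Longrightarrow> pabs (f (Suc N) - f N) < e / 2"
      using LIMSEQ_D[OF assms, of "e / 2"] by auto
    then have M: "pabs (f (Suc N) - f N) \<le> e / 2" if "N \<ge> M" for N
      using that by (simp add: less_imp_le)
    have *: "pabs (f N - f M) \<le> e / 2" if "N \<ge> M" for N
      using that
    proof (induction N rule: dec_induct)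
      case base
      then show ?case using \<open>e > 0\<close> by simp
    next
      case (step k)
      then show ?case using pabs_add_le[OF M[of k] step.IH] by simp
    qed
    show "\<exists>M. \<forall>m\<ge>M. \<forall>n\<ge>M. dist (f m) (f n) < e"
    proof (intro exI allI impI)
      fix m n assume "m \<ge> M" "n \<ge> M"
      then have "pabs ((f m - f M) - (f n - f M)) \<le> e / 2"
        by (intro pabs_diff_le *)
      then show "dist (f m) (f n) < e" using \<open>e > 0\<close> by (simp add: dist_eq)
    qed
  qed
  then show ?thesis by (rule Cauchy_convergent)
qed

section \<open>The p-adic integers as limits of natural numbers\<close>

lemma inverse_p_power_tendsto: "(\<lambda>N. (1 / real p) ^ N) \<longlonglongrightarrow> 0"
  using p_gt_1 by (intro LIMSEQ_realpow_zero) auto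

text \<open>A fraction a/b in lowest terms close to x has absolute value at most 1, so p does not
  divide b. Hence b is invertible modulo p^N, and the residue k of a/b is as close to a/b as
  required because |b| = 1.\<close>

lemma Zp_of_nat_approx:
  assumes "x \<in> (Zp :: 'a set)"
  shows "\<exists>k. pabs (of_nat k - x) \<le> (1 / real p) ^ N"
proof -
  define e where "e = (1 / real p) ^ N"
  have e: "0 < e" "e \<le> 1" unfolding e_def using p_gt_1 by (auto intro: power_le_one)
  have "x \<in> closure (range of_rat)" and x1: "pabs x \<le> 1"
    using assms by (auto simp: Zp_def Qp_def)
  then obtain r where r: "dist (of_rat r) x < e"
    using e(1) unfolding closure_approachable by blast
  obtain a b where ab: "r = Rat.Fract a b" "b > 0" "coprime a b"
    by (cases r) auto
  have r': "(of_rat r :: 'a) = of_int a / of_int b"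
    using ab by (simp add: of_rat_rat)
  have "pabs (of_rat r - x) \<le> e" using r by (simp add: dist_eq)
  then have "pabs ((of_rat r - x) + x) \<le> 1"
    using e x1 by (intro pabs_add_le) auto
  then have le1: "pabs (of_int a :: 'a) \<le> pabs (of_int b :: 'a)"
    using ab(2) pabs_pos[of "of_int b"] by (simp add: r' pabs_divide divide_le_eq)
  have "coprime b (int p)"
  proof (rule ccontr)
    assume "\<not> coprime b (int p)"
    then have pb: "int p dvd b"
      using coprime_p by blast
    then have "\<not> int p dvd a"
      using coprime_common_divisor[OF ab(3), of "int p"] p_gt_1 by auto
    then have "coprime a (int p)" by (rule coprime_p)
    then have "pabs (of_int a :: 'a) = 1" by (rule pabs_of_int_coprime)
    moreover obtain c where "b = int p * c" using pb by blast
    then have "pabs (of_int b :: 'a) = pabs (of_int c :: 'a) / real p"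
      by (simp add: pabs_mult pabs_p)
    moreover have "\<dots> \<le> 1 / real p" by (intro divide_right_mono) auto
    moreover have "1 / real p < 1" using p_gt_1 by simp
    ultimately show False using le1 by linarith
  qed
  then have b1: "pabs (of_int b :: 'a) = 1" and "coprime b (int p ^ N)"
    by (auto simp: pabs_of_int_coprime)
  then obtain c where "[b * c = 1] (mod int p ^ N)"
    using cong_solve_coprime_int by blast
  then have "[b * c * a = 1 * a] (mod int p ^ N)" by (rule cong_scalar_right)
  define k where "k = nat ((c * a) mod (int p ^ N))"
  have k: "int k = (c * a) mod (int p ^ N)" unfolding k_def using p_gt_1 by simp
  have "[b * int k = b * (c * a)] (mod int p ^ N)"
    unfolding k by (intro cong_scalar_left) simp
  also have "[b * (c * a) = a] (mod int p ^ N)"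
    using \<open>[b * c * a = 1 * a] (mod int p ^ N)\<close> by (simp add: mult.assoc)
  finally obtain d where d: "b * int k - a = int p ^ N * d"
    unfolding cong_iff_dvd_diff by blast
  have "of_nat k - of_rat r = (of_int (b * int k - a) / of_int b :: 'a)"
    using ab(2) by (simp add: r' field_simps)
  also have "pabs \<dots> = e * pabs (of_int d :: 'a)"
    unfolding d by (simp add: pabs_divide b1 pabs_mult pabs_power pabs_p e_def)
  also have "\<dots> \<le> e * 1" using e by (intro mult_left_mono) auto
  finally have "pabs (of_nat k - of_rat r :: 'a) \<le> e" by simp
  then have "pabs ((of_nat k - of_rat r) + (of_rat r - x)) \<le> e"
    using \<open>pabs (of_rat r - x) \<le> e\<close> by (rule pabs_add_le)
  then show ?thesis unfolding e_def by (auto intro: exI[of _ k])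
qed

lemma Zp_of_nat_approx_seq:
  assumes "x \<in> (Zp :: 'a set)"
  shows "\<exists>k. \<forall>i. pabs (of_nat (k i) - x) \<le> (1 / real p) ^ i"
  using assms by (intro choice allI Zp_of_nat_approx)

text \<open>This is the form in which membership is used below: identities for natural exponents
  pass to \<open>Zp\<close> by taking limits of sequences.\<close>

lemma Zp_iff: "(x :: 'a) \<in> Zp \<longleftrightarrow> (\<exists>k :: nat \<Rightarrow> nat. (\<lambda>i. of_nat (k i)) \<longlonglongrightarrow> x)"
proof
  assume "x \<in> Zp"
  then obtain k where k: "\<forall>i. pabs (of_nat (k i) - x) \<le> (1 / real p) ^ i"
    using Zp_of_nat_approx_seq by blast
  have "(\<lambda>i. of_nat (k i)) \<longlonglongrightarrow> x"
    unfolding tendsto_iff_pabs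
    by (rule Lim_null_comparison[OF _ inverse_p_power_tendsto]) (simp add: k)
  then show "\<exists>k :: nat \<Rightarrow> nat. (\<lambda>i. of_nat (k i)) \<longlonglongrightarrow> x" by (rule exI[of _ k])
next
  assume "\<exists>k :: nat \<Rightarrow> nat. (\<lambda>i. of_nat (k i)) \<longlonglongrightarrow> x"
  then obtain k :: "nat \<Rightarrow> nat" where k: "(\<lambda>i. of_nat (k i)) \<longlonglongrightarrow> x" by blast
  have "(of_nat m :: 'a) \<in> range of_rat" for m
    by (rule range_eqI[of _ _ "of_nat m"]) simp
  then have "x \<in> closure (range of_rat)"
    unfolding closure_sequential by (intro exI[of _ "\<lambda>i. of_nat (k i)"] conjI allI k)
  moreover have "pabs x \<le> 1" using k by (rule pabs_le_limit) simp
  ultimately show "x \<in> Zp" by (simp add: Zp_def Qp_def)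
qed

lemma Zp_of_nat [simp]: "(of_nat m :: 'a) \<in> Zp"
  unfolding Zp_iff by (rule exI[of _ "\<lambda>_. m"]) simp

lemma Zp_add:
  assumes "x \<in> (Zp :: 'a set)" "y \<in> Zp"
  shows "x + y \<in> Zp"
proof -
  obtain k l :: "nat \<Rightarrow> nat" where k: "(\<lambda>i. of_nat (k i)) \<longlonglongrightarrow> x" and l: "(\<lambda>i. of_nat (l i)) \<longlonglongrightarrow> y"
    using assms Zp_iff by blast
  have "(\<lambda>i. of_nat (k i + l i)) \<longlonglongrightarrow> x + y" using tendsto_addI[OF k l] by simp
  then show ?thesis unfolding Zp_iff by (rule exI[of _ "\<lambda>i. k i + l i"])
qed

text \<open>Negatives of natural numbers are not natural, so \<open>Zp_iff\<close> does not apply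
  directly to the negated sequence; they are rational, and the definition through the closure of the
  rationals is used instead.\<close>

lemma Zp_minus:
  assumes "x \<in> (Zp :: 'a set)"
  shows "- x \<in> Zp"
proof -
  obtain k :: "nat \<Rightarrow> nat" where k: "(\<lambda>i. of_nat (k i)) \<longlonglongrightarrow> x"
    using assms Zp_iff by blast
  have "(\<lambda>i. - of_nat (k i)) \<longlonglongrightarrow> - x"
    using tendsto_multI[OF tendsto_const[of "-1"] k] by simp
  moreover have "- of_nat m \<in> range (of_rat :: rat \<Rightarrow> 'a)" for m
    by (rule range_eqI[of _ _ "- of_nat m"]) (simp add: of_rat_minus)
  ultimately have "- x \<in> closure (range of_rat)"
    unfolding closure_sequential by (intro exI[of _ "\<lambda>i. - of_nat (k i)"] conjI allI)
  then show ?thesis using assms by (simp add: Zp_def Qp_def)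
qed

end

section \<open>Powers of q and geometric sums\<close>

locale Cp_q = Cp p "TYPE('a)" for p :: nat and q :: "'a :: {field_char_0, complete_space}" +
  assumes q: "pabs (1 - q) < 1"
begin

lemma pabs_q [simp]: "pabs q = 1"
proof (rule antisym)
  show "pabs q \<le> 1" using pabs_diff_le[of 1 1 "1 - q"] q by simp
  show "1 \<le> pabs q" using pabs_add[of "1 - q" q] q by simp
qed

lemma q_nonzero [simp]: "q \<noteq> 0"
  using pabs_q by fastforce

text \<open>By symmetry, everything proved for q becomes available for 1/q.\<close>

lemma Cp_q_inverse: "Cp_q p (1 / q)"
proof unfold_locales
  have "1 - 1 / q = - ((1 - q) / q)" by (simp add: field_simps)
  then show "pabs (1 - 1 / q) < 1" using q by (simp add: pabs_divide)
qed

text \<open>The rate \<rho> must dominate both |1 - q| and |p|, since a sum of p powers of q is p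
  plus terms q^m - 1. Including 1/p also keeps it positive when q = 1.\<close>

definition \<rho> :: real where "\<rho> = max (pabs (1 - q)) (1 / real p)"

lemma \<rho>: "0 < \<rho>" "\<rho> < 1" "pabs (1 - q) \<le> \<rho>" "1 / real p \<le> \<rho>"
  using q p_gt_1 by (auto simp: \<rho>_def less_max_iff_disj)

lemma pabs_sum_q: "pabs (\<Sum>j<m. q ^ j) \<le> 1"
  by (intro pabs_sum_le) (auto simp: pabs_power)

lemma one_minus_q_power: "1 - q ^ m = (1 - q) * (\<Sum>j<m. q ^ j)"
  by (rule one_diff_power_eq)

lemma pabs_q_power_diff: "pabs (q ^ m - 1) \<le> \<rho>"
proof -
  have "pabs (q ^ m - 1) = pabs (1 - q) * pabs (\<Sum>j<m. q ^ j)"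
    by (metis pabs_minus_commute one_minus_q_power pabs_mult)
  also have "\<dots> \<le> pabs (1 - q) * 1" by (intro mult_left_mono pabs_sum_q) auto
  finally show ?thesis using \<rho> by simp
qed

lemma sum_lessThan_p_power_Suc:
  fixes h :: "nat \<Rightarrow> 'a"
  shows "(\<Sum>y<p ^ Suc N. h y) = (\<Sum>a<p. \<Sum>y<p ^ N. h (y + a * p ^ N))"
proof -
  have "(\<Sum>y<p ^ Suc N. h y) = (\<Sum>a<p. sum h {a * p ^ N..<a * p ^ N + p ^ N})"
    by (simp add: sum.nat_group)
  moreover have "sum h {a * p ^ N..<a * p ^ N + p ^ N} = (\<Sum>y<p ^ N. h (y + a * p ^ N))" for a
    using sum.shift_bounds_nat_ivl[of h 0 "a * p ^ N" "p ^ N"]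
    by (simp add: add.commute lessThan_atLeast0)
  ultimately show ?thesis by simp
qed

text \<open>This is the factorization of [p^(N+1)]_q as [p]_r [p^N]_q with r = q^(p^N).\<close>

lemma sum_q_p_power_Suc:
  "(\<Sum>j<p ^ Suc N. q ^ j) = (\<Sum>a<p. q ^ (a * p ^ N)) * (\<Sum>j<p ^ N. q ^ j)"
  unfolding sum_lessThan_p_power_Suc 
  by (simp only: power_add flip: sum_distrib_left sum_distrib_right) (rule mult.commute)

lemma pabs_sum_q_p_power: "pabs (\<Sum>j<p ^ N. q ^ j) \<le> \<rho> ^ N"
proof (induction N)
  case (Suc N)
  \<comment> \<open>Removing 1 from each of the p summands exhibits the new factor as p plus small
    terms, so every factor gains at least one \<rho>.\<close>
  have "(\<Sum>a<p. q ^ (a * p ^ N)) = (\<Sum>a<p. q ^ (a * p ^ N) - 1) + of_nat p"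
    by (simp add: sum_subtractf)
  also have "pabs \<dots> \<le> \<rho>"
    using \<rho> by (intro pabs_add_le pabs_sum_le pabs_q_power_diff) (auto simp: pabs_p)
  finally show ?case
    using Suc \<rho> unfolding sum_q_p_power_Suc pabs_mult power_Suc[of \<rho>] by (intro mult_mono) auto
qed simp

lemma pabs_q_p_power_diff: "pabs (q ^ p ^ N - 1) \<le> \<rho> ^ N"
proof -
  have "pabs (q ^ p ^ N - 1) = pabs (1 - q) * pabs (\<Sum>j<p ^ N. q ^ j)"
    by (metis pabs_minus_commute one_minus_q_power pabs_mult)
  also have "\<dots> \<le> 1 * \<rho> ^ N" using q \<rho> by (intro mult_mono pabs_sum_q_p_power) auto
  finally show ?thesis by simp
qed

section \<open>Sums of p-adically continuous functions\<close>

text \<open>The modulus of continuity is the one of \<open>y \<mapsto> q\<^sup>y\<close>, see \<open>rho_cont_q_power\<close>.\<close>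

definition rho_cont :: "(nat \<Rightarrow> 'a) \<Rightarrow> bool" where
  "rho_cont h \<longleftrightarrow> (\<forall>y. pabs (h y) \<le> 1) \<and> (\<forall>N y. pabs (h (y + p ^ N) - h y) \<le> \<rho> ^ N)"

lemma rho_cont_mult:
  assumes "rho_cont f" "rho_cont g"
  shows "rho_cont (\<lambda>y. f y * g y)"
  unfolding rho_cont_def
proof (intro conjI allI)
  fix y N
  have fg: "pabs (f z) \<le> 1" "pabs (g z) \<le> 1" "pabs (f (z + p ^ N) - f z) \<le> \<rho> ^ N"
    "pabs (g (z + p ^ N) - g z) \<le> \<rho> ^ N" for z
    using assms by (auto simp: rho_cont_def)
  show "pabs (f y * g y) \<le> 1"
    using fg by (auto simp: pabs_mult intro: mult_le_one)
  have "f (y + p ^ N) * g (y + p ^ N) - f y * g y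
      = (f (y + p ^ N) - f y) * g (y + p ^ N) + f y * (g (y + p ^ N) - g y)"
    by (simp add: algebra_simps)
  also have "pabs \<dots> \<le> \<rho> ^ N"
  proof (rule pabs_add_le)
    show "pabs ((f (y + p ^ N) - f y) * g (y + p ^ N)) \<le> \<rho> ^ N"
      using mult_mono[OF fg(3)[of y] fg(2)[of "y + p ^ N"]] \<rho> by (simp add: pabs_mult)
    show "pabs (f y * (g (y + p ^ N) - g y)) \<le> \<rho> ^ N"
      using mult_mono[OF fg(1)[of y] fg(4)[of y]] \<rho> by (simp add: pabs_mult)
  qed
  finally show "pabs (f (y + p ^ N) * g (y + p ^ N) - f y * g y) \<le> \<rho> ^ N" .
qed

lemma rho_cont_power: "rho_cont f \<Longrightarrow> rho_cont (\<lambda>y. f y ^ n)"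
proof (induction n)
  case 0
  then show ?case using \<rho> by (simp add: rho_cont_def)
next
  case (Suc n)
  then show ?case using rho_cont_mult by simp
qed

lemma rho_cont_shift:
  assumes "rho_cont h"
  shows "pabs (h (y + a * p ^ N) - h y) \<le> \<rho> ^ N"
proof (induction a)
  case 0
  then show ?case using \<rho> by simp
next
  case (Suc a)
  have "pabs (h (y + a * p ^ N + p ^ N) - h (y + a * p ^ N)) \<le> \<rho> ^ N"
    using assms by (simp add: rho_cont_def)
  from pabs_add_le[OF this Suc] show ?case by (simp add: algebra_simps)
qed

text \<open>The factor \<rho> on the left expresses the bound \<rho>^(N-1) without a subtraction in
  the exponent. In the induction, each of the p blocks of length p^N is replaced by the first one;
  this costs at most \<rho>^N, and the resulting multiple p of the old sum gains the factor
  1/p.\<close>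

lemma rho_cont_sum:
  assumes "rho_cont h"
  shows "\<rho> * pabs (\<Sum>y<p ^ N. h y) \<le> \<rho> ^ N"
proof (induction N)
  case 0
  have "\<rho> * pabs (h 0) \<le> 1 * 1"
    using assms \<rho> by (intro mult_mono) (auto simp: rho_cont_def)
  then show ?case by simp
next
  case (Suc N)
  let ?S = "\<Sum>y<p ^ N. h y"
  have "(\<Sum>y<p ^ Suc N. h y)
      = of_nat p * ?S + (\<Sum>a<p. \<Sum>y<p ^ N. h (y + a * p ^ N) - h y)"
    unfolding sum_lessThan_p_power_Suc by (simp add: sum_subtractf)
  also have "pabs \<dots> \<le> \<rho> ^ N"
  proof (intro pabs_add_le pabs_sum_le rho_cont_shift assms)
    have "pabs (of_nat p * ?S) \<le> \<rho> * pabs ?S"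
      unfolding pabs_mult pabs_p using \<rho> by (intro mult_right_mono) auto
    with Suc show "pabs (of_nat p * ?S) \<le> \<rho> ^ N" by linarith
  qed (use \<rho> in auto)
  finally show ?case using \<rho> by simp
qed

lemma rho_cont_q_power: "rho_cont (\<lambda>y. q ^ y)"
  unfolding rho_cont_def
proof (intro conjI allI)
  fix y N
  show "pabs (q ^ y) \<le> 1" by (simp add: pabs_power)
  have "q ^ (y + p ^ N) - q ^ y = q ^ y * (q ^ p ^ N - 1)"
    by (simp add: power_add algebra_simps)
  also have "pabs \<dots> \<le> \<rho> ^ N"
    using pabs_q_p_power_diff[of N] by (simp add: pabs_mult pabs_power)
  finally show "pabs (q ^ (y + p ^ N) - q ^ y) \<le> \<rho> ^ N" .
qed

section \<open>Powers of q with p-adic exponents\<close>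

lemma pabs_q_power_diff_le:
  assumes "pabs (of_nat k - of_nat m :: 'a) \<le> (1 / real p) ^ N"
  shows "pabs (q ^ k - q ^ m) \<le> \<rho> ^ N"
  using assms
proof (induction k m rule: linorder_wlog)
  case (le m k)
  have "pabs (of_int (int k - int m) :: 'a) \<le> (1 / real p) ^ N"
    using le(2) by (simp add: pabs_minus_commute)
  then have "int p ^ N dvd int k - int m" by (rule p_power_dvd)
  then have "int (p ^ N) dvd int (k - m)" using le(1) by (simp add: of_nat_diff)
  then obtain a where "k - m = a * p ^ N" by (metis dvd_def mult.commute of_nat_dvd_iff)
  then have "k = m + a * p ^ N" using le(1) by simp
  then show ?case
    using rho_cont_shift[OF rho_cont_q_power, of m a N] by (simp add: pabs_minus_commute)
next
  case (sym m k)
  then show ?case by (simp add: pabs_minus_commute)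
qed

text \<open>The \<open>Lim\<close> in \<open>qpow\<close> has its intended value only once the limit
  is known to exist. Along one sequence of natural approximations of x the powers of q converge, and
  by \<open>pabs_q_power_diff_le\<close> all natural exponents near x give nearly the same
  power.\<close>

lemma tendsto_qpow_filter:
  assumes "x \<in> Zp"
  shows "((\<lambda>k. q ^ k) \<longlongrightarrow> qpow q x) (filtercomap of_nat (nhds x))"
proof -
  obtain k where k: "\<And>i. pabs (of_nat (k i) - x) \<le> (1 / real p) ^ i"
    using Zp_of_nat_approx_seq[OF assms] by blast
  have close: "pabs (q ^ m - q ^ k N) \<le> \<rho> ^ N"
    if "pabs (of_nat m - x) \<le> (1 / real p) ^ N" for m N
    using pabs_q_power_diff_le[of m "k N" N] pabs_diff_le[OF that k[of N]] by simp
  have \<rho>0: "(\<lambda>N. \<rho> ^ N) \<longlonglongrightarrow> 0" using \<rho> by (intro LIMSEQ_realpow_zero) auto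
  have dec: "(1 / real p) ^ Suc N \<le> (1 / real p) ^ N" for N
    using p_gt_1 by (intro power_decreasing) auto
  have "convergent (\<lambda>i. q ^ k i)"
  proof (rule convergent_of_diff_tendsto_0, rule Lim_null_comparison[OF _ \<rho>0])
    show "\<forall>\<^sub>F N in sequentially. norm (pabs (q ^ k (Suc N) - q ^ k N)) \<le> \<rho> ^ N"
      using close[OF order_trans[OF k dec]] by simp
  qed
  then obtain L where L: "(\<lambda>i. q ^ k i) \<longlonglongrightarrow> L" by (auto simp: convergent_def)
  let ?F = "filtercomap (of_nat :: nat \<Rightarrow> 'a) (nhds x)"
  have lim: "((\<lambda>k. q ^ k) \<longlongrightarrow> L) ?F"
  proof (rule tendstoI)
    fix e :: real assume "e > 0"
    have "\<forall>\<^sub>F N in sequentially. \<rho> ^ N < e / 2"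
      using \<open>e > 0\<close> order_tendstoD(2)[OF \<rho>0, of "e / 2"] by simp
    moreover have "\<forall>\<^sub>F N in sequentially. dist (q ^ k N) L < e / 2"
      using \<open>e > 0\<close> by (intro tendstoD[OF L]) auto
    ultimately have "\<forall>\<^sub>F N in sequentially. \<rho> ^ N < e / 2 \<and> dist (q ^ k N) L < e / 2"
      by (rule eventually_conj)
    then obtain N where N: "\<rho> ^ N < e / 2" "dist (q ^ k N) L < e / 2"
      by (auto simp: eventually_sequentially)
    have "dist (q ^ m) L < e" if "dist (of_nat m) x < (1 / real p) ^ N" for m
      using close[of m N] that N dist_triangle[of "q ^ m" L "q ^ k N"] by (simp add: dist_eq)
    moreover have "\<forall>\<^sub>F m in ?F. dist (of_nat m) x < (1 / real p) ^ N"
      unfolding eventually_filtercomap eventually_nhds_metric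
      by (rule exI[of _ "\<lambda>z. dist z x < (1 / real p) ^ N"])
        (use p_gt_1 in \<open>auto intro!: exI[of _ "(1 / real p) ^ N"]\<close>)
    ultimately show "\<forall>\<^sub>F m in ?F. dist (q ^ m) L < e" by (auto elim: eventually_mono)
  qed
  \<comment> \<open>Uniqueness of the limit needs a nontrivial filter: there are natural numbers
    arbitrarily close to x.\<close>
  have "?F \<noteq> bot"
  proof
    assume "?F = bot"
    then have "\<forall>\<^sub>F m in ?F. False" by simp
    then obtain d where d: "d > 0" "\<And>m. \<not> dist (of_nat m) x < d"
      unfolding eventually_filtercomap eventually_nhds_metric by blast
    obtain N where "(1 / real p) ^ N < d"
      using order_tendstoD(2)[OF inverse_p_power_tendsto d(1)]
      by (auto simp: eventually_sequentially)
    with k[of N] d(2)[of "k N"] show False by (simp add: dist_eq)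
  qed
  then have "qpow q x = L" unfolding qpow_def using lim by (rule tendsto_Lim)
  with lim show ?thesis by simp
qed

lemma tendsto_qpow:
  assumes "(\<lambda>i. of_nat (k i)) \<longlonglongrightarrow> x"
  shows "(\<lambda>i. q ^ k i) \<longlonglongrightarrow> qpow q x"
proof -
  have "x \<in> Zp" using assms Zp_iff by blast
  moreover have "filterlim k (filtercomap of_nat (nhds x)) sequentially"
    using assms by (simp add: filterlim_filtercomap_iff o_def)
  ultimately show ?thesis using filterlim_compose[OF tendsto_qpow_filter] by blast
qed

lemma qpow_of_nat [simp]: "qpow q (of_nat m) = q ^ m"
  using tendsto_qpow[of "\<lambda>_. m" "of_nat m"] by (simp add: LIMSEQ_const_iff)

lemma qpow_add:
  assumes "x \<in> Zp" "y \<in> Zp"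
  shows "qpow q (x + y) = qpow q x * qpow q y"
proof -
  obtain k l :: "nat \<Rightarrow> nat" where k: "(\<lambda>i. of_nat (k i)) \<longlonglongrightarrow> x" and l: "(\<lambda>i. of_nat (l i)) \<longlonglongrightarrow> y"
    using assms Zp_iff by blast
  have "(\<lambda>i. of_nat (k i + l i)) \<longlonglongrightarrow> x + y" using tendsto_addI[OF k l] by simp
  then have "(\<lambda>i. q ^ k i * q ^ l i) \<longlonglongrightarrow> qpow q (x + y)"
    using tendsto_qpow[of "\<lambda>i. k i + l i"] by (simp add: power_add)
  moreover have "(\<lambda>i. q ^ k i * q ^ l i) \<longlonglongrightarrow> qpow q x * qpow q y"
    by (intro tendsto_multI tendsto_qpow k l)
  ultimately show ?thesis by (rule LIMSEQ_unique)
qed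

lemma qpow_minus_mult:
  assumes "x \<in> Zp"
  shows "qpow q (- x) * qpow q x = 1"
  using qpow_add[OF Zp_minus[OF assms] assms] qpow_of_nat[of 0] by simp

lemma pabs_qpow [simp]:
  assumes "x \<in> Zp"
  shows "pabs (qpow q x) = 1"
proof -
  have le: "pabs (qpow q y) \<le> 1" if "y \<in> Zp" for y
    using that Zp_iff[of y] tendsto_qpow pabs_le_limit[of "\<lambda>i. q ^ _ i" "qpow q y" 1]
    by (auto simp: pabs_power)
  have "1 = pabs (qpow q (- x)) * pabs (qpow q x)"
    by (metis assms pabs_1 pabs_mult qpow_minus_mult)
  also have "\<dots> \<le> 1 * pabs (qpow q x)"
    using le[OF Zp_minus[OF assms]] by (intro mult_right_mono) auto
  finally show ?thesis using le[OF assms] by simp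
qed

text \<open>Both sides are inverse to (1/q)^x: the left one by \<open>qpow_minus_mult\<close> for
  1/q, the right one as a limit of the identities (1/q)^k q^k = 1.\<close>

lemma qpow_inverse_base:
  assumes "x \<in> Zp"
  shows "qpow (1 / q) (- x) = qpow q x"
proof -
  interpret inv: Cp_q p "1 / q" by (rule Cp_q_inverse)
  obtain k :: "nat \<Rightarrow> nat" where k: "(\<lambda>i. of_nat (k i)) \<longlonglongrightarrow> x"
    using assms Zp_iff by blast
  have "(\<lambda>i. (1 / q) ^ k i * q ^ k i) \<longlonglongrightarrow> qpow (1 / q) x * qpow q x"
    by (intro tendsto_multI tendsto_qpow inv.tendsto_qpow k)
  then have "qpow (1 / q) x * qpow q x = 1"
    by (simp add: LIMSEQ_const_iff flip: power_mult_distrib)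
  then show ?thesis using inv.qpow_minus_mult[OF assms]
    by (metis mult.assoc mult.commute mult_1)
qed

section \<open>The q-numbers\<close>

lemma qnum_of_nat: "qnum q (of_nat m) = (\<Sum>j<m. q ^ j)"
  by (auto simp: qnum_def one_minus_q_power)

lemma qnum_add:
  assumes "x \<in> Zp" "y \<in> Zp"
  shows "qnum q (x + y) = qnum q x + qpow q x * qnum q y"
proof (cases "q = 1")
  case True
  obtain k :: "nat \<Rightarrow> nat" where k: "(\<lambda>i. of_nat (k i)) \<longlonglongrightarrow> x"
    using assms Zp_iff by blast
  have "qpow q x = 1" using tendsto_qpow[OF k] True by (simp add: LIMSEQ_const_iff)
  with True show ?thesis by (simp add: qnum_def)
next
  case False
  then show ?thesis by (simp add: qnum_def qpow_add assms field_simps)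
qed

lemma qnum_inverse_base:
  assumes "x \<in> Zp"
  shows "qnum (1 / q) (- x) = - q * qnum q x"
proof (cases "q = 1")
  case False
  then have "1 - q \<noteq> 0" "1 - 1 / q \<noteq> 0" by auto
  then show ?thesis using False by (simp add: qnum_def qpow_inverse_base assms field_simps)
qed (simp add: qnum_def)

text \<open>The denominator 1 - q may be small, so the quotient gives no direct bound. For q other
  than 1 the q-number is instead a limit of geometric sums, which have absolute value at most
  1.\<close>

lemma pabs_qnum:
  assumes "x \<in> Zp"
  shows "pabs (qnum q x) \<le> 1"
proof (cases "q = 1")
  case True
  then show ?thesis using assms by (simp add: qnum_def Zp_def)
next
  case False
  obtain k :: "nat \<Rightarrow> nat" where k: "(\<lambda>i. of_nat (k i)) \<longlonglongrightarrow> x"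
    using assms Zp_iff by blast
  have "(\<lambda>i. (1 / (1 - q)) * (1 + (-1) * q ^ k i))
      \<longlonglongrightarrow> (1 / (1 - q)) * (1 + (-1) * qpow q x)"
    by (intro tendsto_multI tendsto_addI tendsto_const tendsto_qpow k)
  then have "(\<lambda>i. qnum q (of_nat (k i))) \<longlonglongrightarrow> qnum q x"
    using False by (simp add: qnum_def)
  then show ?thesis by (rule pabs_le_limit) (simp add: qnum_of_nat pabs_sum_q)
qed

lemma rho_cont_qpow:
  assumes "x \<in> Zp"
  shows "rho_cont (\<lambda>y. qpow q (x + of_nat y))"
  using rho_cont_q_power assms
  by (simp add: rho_cont_def qpow_add pabs_mult flip: right_diff_distrib)

lemma rho_cont_qnum:
  assumes "x \<in> Zp"
  shows "rho_cont (\<lambda>y. qnum q (x + of_nat y))"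
  unfolding rho_cont_def
proof (intro conjI allI)
  fix y N
  have xy: "x + of_nat y \<in> Zp" using assms by (simp add: Zp_add)
  then show "pabs (qnum q (x + of_nat y)) \<le> 1" by (rule pabs_qnum)
  have "qnum q (x + of_nat (y + p ^ N)) = qnum q ((x + of_nat y) + of_nat (p ^ N))"
    by (simp add: add.assoc)
  \<comment> \<open>The increment is a power of q, of absolute value 1, times [p^N]_q, so
    \<open>pabs_sum_q_p_power\<close> bounds it.\<close>
  also have "\<dots> = qnum q (x + of_nat y) + qpow q (x + of_nat y) * (\<Sum>j<p ^ N. q ^ j)"
    by (subst qnum_add[OF xy]) (simp_all only: Zp_of_nat qnum_of_nat)
  finally show "pabs (qnum q (x + of_nat (y + p ^ N)) - qnum q (x + of_nat y)) \<le> \<rho> ^ N"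
    using pabs_sum_q_p_power[of N] xy by (simp add: pabs_mult)
qed

section \<open>The approximations I_N(x) and their convergence\<close>

definition qsum :: "'a \<Rightarrow> nat \<Rightarrow> nat \<Rightarrow> 'a" where
  "qsum x n N = 1 / qnum q (of_nat (p ^ N)) *
     (\<Sum>y<p ^ N. qnum q (x + of_nat y) ^ n * q ^ y)"

text \<open>
  With \<open>A\<^sub>y = [x + y]\<^sub>q\<close>, \<open>B\<^sub>y = q\<^bsup>x + y\<^esup>\<close> and \<open>e = [z]\<^sub>q\<close>, one has
  \<open>[x + y + z]\<^sub>q = A\<^sub>y + e B\<^sub>y\<close>. The binomial expansion cancels the term without \<open>e\<close>, and every
  other one is \<open>e\<close> times the sum of a \<open>rho_cont\<close> function.
\<close>

lemma qsum_shift: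
  assumes "x \<in> Zp" "z \<in> Zp" and z: "pabs (qnum q z) \<le> pabs (qnum q (of_nat (p ^ N)))"
  shows "\<rho> * pabs (qsum (x + z) n N - qsum x n N) \<le> \<rho> ^ N"
proof (cases "qnum q (of_nat (p ^ N)) = 0")
  \<comment> \<open>Division by zero makes both approximations 0 here.\<close>
  case True
  then show ?thesis using \<rho> by (simp add: qsum_def)
next
  case False
  define P where "P = qnum q (of_nat (p ^ N))"
  define e where "e = qnum q z"
  define A where "A y = qnum q (x + of_nat y)" for y
  define B where "B y = qpow q (x + of_nat y)" for y
  define h where "h k y = B y ^ k * A y ^ (n - k) * q ^ y" for k y
  have h: "rho_cont (h k)" for k
    unfolding h_def A_def B_def
    by (intro rho_cont_mult rho_cont_power rho_cont_q_power rho_cont_qpow rho_cont_qnum assms)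
  have P: "P \<noteq> 0" "pabs P > 0" using False by (simp_all add: P_def)
  \<comment> \<open>One factor e pays for the division by [p^N]_q; the remaining factors e^k only
    need to be bounded by 1.\<close>
  have eP: "pabs (e / P) \<le> 1" using z P by (simp add: pabs_divide e_def P_def)
  have e1: "pabs e \<le> 1" unfolding e_def using assms(2) by (rule pabs_qnum)
  have shift: "qnum q (x + z + of_nat y) = A y + e * B y" for y
    using qnum_add[of "x + of_nat y" z] assms
    by (simp add: Zp_add A_def B_def e_def algebra_simps)
  have "(A y + e * B y) ^ n * q ^ y
      = A y ^ n * q ^ y + (\<Sum>k<n. of_nat (n choose Suc k) * e ^ Suc k * h (Suc k) y)" for y
  proof -
    have "(A y + e * B y) ^ n = (\<Sum>k\<le>n. of_nat (n choose k) * (e * B y) ^ k * A y ^ (n - k))"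
      by (simp add: binomial_ring[symmetric] add.commute)
    also have "\<dots> = A y ^ n
        + (\<Sum>k<n. of_nat (n choose Suc k) * (e * B y) ^ Suc k * A y ^ (n - Suc k))"
      by (subst sum.atMost_shift) simp
    finally show ?thesis
      by (simp add: h_def distrib_left sum_distrib_left power_mult_distrib mult_ac)
  qed
  then have "qsum (x + z) n N - qsum x n N
      = 1 / P * (\<Sum>y<p ^ N. \<Sum>k<n. of_nat (n choose Suc k) * e ^ Suc k * h (Suc k) y)"
    by (simp add: qsum_def shift P_def sum.distrib distrib_left flip: A_def)
  also have "\<dots> = (\<Sum>k<n. of_nat (n choose Suc k) * (e / P) * e ^ k * (\<Sum>y<p ^ N. h (Suc k) y))"
    by (subst sum.swap) (simp add: sum_distrib_left sum_divide_distrib mult_ac)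
  finally have eq: "qsum (x + z) n N - qsum x n N = \<dots>" .
  have "pabs (qsum (x + z) n N - qsum x n N) \<le> \<rho> ^ N / \<rho>"
    unfolding eq
  proof (rule pabs_sum_le)
    fix k
    have "pabs (of_nat (n choose Suc k) * (e / P) * e ^ k :: 'a) \<le> 1"
      unfolding pabs_mult pabs_power
      by (intro mult_le_one power_le_one mult_nonneg_nonneg) (use eP e1 in auto)
    moreover have "pabs (\<Sum>y<p ^ N. h (Suc k) y) \<le> \<rho> ^ N / \<rho>"
      using rho_cont_sum[OF h, of "Suc k" N] \<rho> by (simp add: field_simps)
    ultimately show "pabs (of_nat (n choose Suc k) * (e / P) * e ^ k * (\<Sum>y<p ^ N. h (Suc k) y))
        \<le> \<rho> ^ N / \<rho>"
      unfolding pabs_mult[of "_ * _ * _"] using mult_mono[of _ 1 _ "\<rho> ^ N / \<rho>"] by fastforce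
  qed (use \<rho> in auto)
  then show ?thesis using \<rho> by (simp add: field_simps)
qed

lemma \<rho>_power_tendsto: "(\<lambda>N. c * \<rho> ^ N) \<longlonglongrightarrow> 0"
  using \<rho> by (intro tendsto_mult_right_zero LIMSEQ_realpow_zero) auto

text \<open>Splitting the range into p blocks and factoring [p^(N+1)]_q presents I_(N+1)(x) as a
  weighted mean of the values I_N(x + a p^N). With division by zero equal to 0 this holds even if a
  denominator vanishes.\<close>

lemma qsum_Suc:
  "qsum x n (Suc N) = (\<Sum>a<p. q ^ (a * p ^ N) * qsum (x + of_nat (a * p ^ N)) n N) /
           (\<Sum>a<p. q ^ (a * p ^ N))"
proof -
  define S where "S = (\<Sum>j<p ^ N. q ^ j)"
  define t where "t a = (\<Sum>y<p ^ N. qnum q (x + of_nat (a * p ^ N) + of_nat y) ^ n * q ^ y)" for a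
  have "(\<Sum>y<p ^ N. qnum q (x + of_nat (y + a * p ^ N)) ^ n * q ^ (y + a * p ^ N))
      = q ^ (a * p ^ N) * t a" for a
    by (simp add: t_def sum_distrib_left power_add add_ac mult_ac)
  then have "qsum x n (Suc N)
      = 1 / ((\<Sum>a<p. q ^ (a * p ^ N)) * S) * (\<Sum>a<p. q ^ (a * p ^ N) * t a)"
    by (simp only: qsum_def sum_lessThan_p_power_Suc[of "\<lambda>y. qnum q (x + of_nat y) ^ n * q ^ y"]
        qnum_of_nat sum_q_p_power_Suc S_def)
  moreover have "(\<Sum>a<p. q ^ (a * p ^ N) * qsum (x + of_nat (a * p ^ N)) n N)
      = (\<Sum>a<p. q ^ (a * p ^ N) * t a) / S"
    unfolding qsum_def t_def[symmetric] qnum_of_nat S_def[symmetric]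
    by (simp add: sum_divide_distrib)
  ultimately show ?thesis by simp
qed

lemma convergent_qsum:
  assumes "x \<in> Zp"
  shows "convergent (qsum x n)"
proof (cases "\<exists>M. qnum q (of_nat (p ^ M)) = 0")
  case True
  then obtain M where M: "qnum q (of_nat (p ^ M)) = 0" by blast
  have "qnum q (of_nat (p ^ N)) = 0" if "N \<ge> M" for N
    using that
  proof (induction N rule: dec_induct)
    case base
    show ?case by (rule M)
  next
    case (step N)
    then show ?case by (simp only: qnum_of_nat sum_q_p_power_Suc mult_zero_right)
  qed
  then have "\<forall>\<^sub>F N in sequentially. qsum x n N = 0"
    unfolding eventually_sequentially qsum_def by (metis div_by_0 mult_zero_left)
  then have "qsum x n \<longlonglongrightarrow> 0" by (rule tendsto_eventually)
  then show ?thesis by (auto simp: convergent_def)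
next
  case False
  let ?u = "\<lambda>N. \<Sum>a<p. q ^ (a * p ^ N)"
  \<comment> \<open>The sum of the weights is p up to an error of at most \<rho>^N. Once this is
    below |p| = 1/p, the sum has absolute value at least 1/p, so dividing by it costs at most a
    factor p.\<close>
  have step: "pabs (qsum x n (Suc N) - qsum x n N) \<le> real p / \<rho> * \<rho> ^ N"
    if N: "\<rho> ^ N < 1 / real p" for N
  proof -
    \<comment> \<open>The redundant 0 and q^0 match \<open>rho_cont_shift\<close> at y = 0.\<close>
    have "pabs (of_nat p :: 'a) = pabs (?u N - (\<Sum>a<p. q ^ (0 + a * p ^ N) - q ^ 0))"
      by (simp add: sum_subtractf)
    also have "\<dots> \<le> max (pabs (?u N)) (pabs (\<Sum>a<p. q ^ (0 + a * p ^ N) - q ^ 0))"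
      using pabs_add[of "?u N" "- (\<Sum>a<p. q ^ (0 + a * p ^ N) - q ^ 0)"]
      unfolding pabs_minus by simp
    finally have "1 / real p \<le> max (pabs (?u N)) (pabs (\<Sum>a<p. q ^ (0 + a * p ^ N) - q ^ 0))"
      by (simp add: pabs_p)
    moreover have "pabs (\<Sum>a<p. q ^ (0 + a * p ^ N) - q ^ 0) \<le> \<rho> ^ N"
      using \<rho> by (intro pabs_sum_le rho_cont_shift[OF rho_cont_q_power]) auto
    ultimately have u: "1 / real p \<le> pabs (?u N)" using N by linarith
    have u0: "?u N \<noteq> 0" using u p_gt_1 by (auto simp del: pabs_eq_0)
    have "qsum x n (Suc N) - qsum x n N
        = (\<Sum>a<p. q ^ (a * p ^ N) * (qsum (x + of_nat (a * p ^ N)) n N - qsum x n N)) / ?u N"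
      using u0
      by (subst qsum_Suc)
        (simp add: right_diff_distrib sum_subtractf diff_divide_distrib flip: sum_distrib_right)
    also have "pabs \<dots> \<le> (\<rho> ^ N / \<rho>) / (1 / real p)"
      unfolding pabs_divide
    proof (intro frac_le pabs_sum_le u)
      fix a
      \<comment> \<open>With r = q^(p^N) this is [a p^N]_q = [a]_r [p^N]_q. Since |[a]_r| is at most
        1, the hypothesis of \<open>qsum_shift\<close> holds for z = a p^N.\<close>
      have "qnum q (of_nat (a * p ^ N)) = (\<Sum>i<a. (q ^ p ^ N) ^ i) * qnum q (of_nat (p ^ N))"
      proof (induction a)
        case (Suc a)
        have "qnum q (of_nat (Suc a * p ^ N)) = qnum q (of_nat (a * p ^ N) + of_nat (p ^ N))"
          by (metis add.commute mult_Suc of_nat_add)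
        also have "\<dots> = qnum q (of_nat (a * p ^ N))
            + q ^ (a * p ^ N) * qnum q (of_nat (p ^ N))"
          by (simp only: qnum_add Zp_of_nat qpow_of_nat)
        finally show ?case
          using Suc by (simp add: algebra_simps flip: power_mult)
      qed (use qnum_of_nat[of 0] in simp)
      moreover have "pabs (\<Sum>i<a. (q ^ p ^ N) ^ i) \<le> 1"
        by (intro pabs_sum_le) (auto simp: pabs_power)
      ultimately have "pabs (qnum q (of_nat (a * p ^ N))) \<le> pabs (qnum q (of_nat (p ^ N)))"
        by (simp only: pabs_mult) (simp add: mult_left_le_one_le)
      from qsum_shift[OF assms Zp_of_nat this]
      show "pabs (q ^ (a * p ^ N) * (qsum (x + of_nat (a * p ^ N)) n N - qsum x n N)) \<le> \<rho> ^ N / \<rho>"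
        unfolding pabs_mult using \<rho> by (simp add: pabs_power field_simps)
    qed (use \<rho> p_gt_1 in auto)
    finally show ?thesis by (simp add: mult_ac)
  qed
  show ?thesis
  proof (rule convergent_of_diff_tendsto_0, rule Lim_null_comparison[OF _ \<rho>_power_tendsto])
    have "\<forall>\<^sub>F N in sequentially. \<rho> ^ N < 1 / real p"
      using order_tendstoD(2)[OF \<rho>_power_tendsto[of 1], of "1 / real p"] p_gt_1 by simp
    then show "\<forall>\<^sub>F N in sequentially.
        norm (pabs (qsum x n (Suc N) - qsum x n N)) \<le> real p / \<rho> * \<rho> ^ N"
      by eventually_elim (use step in simp)
  qed
qed

section \<open>Reflection and the comparison of the two integrals\<close>

lemma qnum_minus:
  assumes "x \<in> Zp"
  shows "qnum q (- x) = - qpow q (- x) * qnum q x"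
  using qnum_add[OF Zp_minus[OF assms] assms] qnum_of_nat[of 0]
  by (simp add: eq_neg_iff_add_eq_0)

text \<open>Under y -> P - 1 - y the 1 in 1 - x absorbs the -1, leaving the argument -(x - P + y).
  The weight becomes q^(1-P) q^y, and q^(1-P) cancels against [P]_(1/q) = q^(1-P) [P]_q.\<close>

lemma qsum_reflect:
  assumes "x \<in> Zp"
  shows "1 / qnum (1 / q) (of_nat (p ^ N)) *
           (\<Sum>y<p ^ N. qnum (1 / q) (1 - x + of_nat y) ^ n * (1 / q) ^ y) =
         (- q) ^ n * qsum (x + - of_nat (p ^ N)) n N"
proof -
  define P where "P = p ^ N"
  have P: "P > 0" using p_gt_1 by (simp add: P_def)
  have qP: "qpow q (- of_nat P) = (1 / q) ^ P"
    using qpow_minus_mult[of "of_nat P"] by (simp add: field_simps)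
  have "qnum (1 / q) (of_nat P) = - q * qnum q (- of_nat P)"
    using qnum_inverse_base[of "- of_nat P"] Zp_minus[of "of_nat P"] by simp
  also have "\<dots> = q * (1 / q) ^ P * qnum q (of_nat P)"
    by (simp add: qnum_minus qP)
  finally have num: "qnum (1 / q) (of_nat P) = q * (1 / q) ^ P * qnum q (of_nat P)" .
  have "(\<Sum>y<P. qnum (1 / q) (1 - x + of_nat y) ^ n * (1 / q) ^ y)
      = (\<Sum>y<P. qnum (1 / q) (1 - x + of_nat (P - Suc y)) ^ n * (1 / q) ^ (P - Suc y))"
    by (rule sum.nat_diff_reindex[symmetric])
  also have "\<dots> = (\<Sum>y<P. (- q) ^ n * (q * (1 / q) ^ P) *
                 (qnum q (x + - of_nat P + of_nat y) ^ n * q ^ y))"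
  proof (rule sum.cong[OF refl])
    fix y assume "y \<in> {..<P}"
    then have y: "Suc y \<le> P" by simp
    have "1 - x + of_nat (P - Suc y) = - (x + - of_nat P + of_nat y)"
      using y by (simp add: of_nat_diff)
    moreover have "x + - of_nat P + of_nat y \<in> Zp"
      using assms by (intro Zp_add Zp_minus) auto
    moreover have "(1 / q) ^ (P - Suc y) = q * (1 / q) ^ P * q ^ y"
      using y by (simp add: power_diff power_one_over field_simps)
    ultimately show "qnum (1 / q) (1 - x + of_nat (P - Suc y)) ^ n * (1 / q) ^ (P - Suc y)
        = (- q) ^ n * (q * (1 / q) ^ P) * (qnum q (x + - of_nat P + of_nat y) ^ n * q ^ y)"
      by (simp only: qnum_inverse_base power_mult_distrib mult_ac)
  qed
  finally show ?thesis
    unfolding P_def[symmetric] qsum_def num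
    by (simp flip: sum_distrib_left)
qed

end

theorem theorem1:
  fixes p :: nat
    and q x :: "'a :: {field_char_0, complete_space}"
    and n :: nat
  assumes "prime p"
    and "is_Cp p TYPE('a)"
    and "pabs (1 - q) < 1"
    and "x \<in> Zp"
  shows "q_integral p (1 / q) (\<lambda>x1. qnum (1 / q) (1 - x + x1) ^ n) =
         (-1) ^ n * q ^ n * q_integral p q (\<lambda>x1. qnum q (x + x1) ^ n)"
proof -
  interpret Cp_q p q using assms by unfold_locales
  define L where "L = lim (qsum x n)"
  have L: "qsum x n \<longlonglongrightarrow> L"
    unfolding L_def using convergent_qsum[OF \<open>x \<in> Zp\<close>] by (simp add: convergent_LIMSEQ_iff)
  have "(\<lambda>N. qsum (x + - of_nat (p ^ N)) n N - qsum x n N) \<longlonglongrightarrow> 0"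
    unfolding tendsto_iff_pabs
  proof (rule Lim_null_comparison[OF _ \<rho>_power_tendsto[of "1 / \<rho>"]])
    \<comment> \<open>The q-numbers of P = p^N and -P differ by the factor -q^(-P) of absolute value
      1, so \<open>qsum_shift\<close> applies with z = -P.\<close>
    have "pabs (qnum q (- of_nat (p ^ N))) \<le> pabs (qnum q (of_nat (p ^ N)))" for N
      by (subst qnum_minus[OF Zp_of_nat]) (simp only: pabs_mult pabs_minus pabs_qpow Zp_minus Zp_of_nat)
    then have "\<rho> * pabs (qsum (x + - of_nat (p ^ N)) n N - qsum x n N) \<le> \<rho> ^ N" for N
      using \<open>x \<in> Zp\<close> by (intro qsum_shift Zp_minus Zp_of_nat)
    then show "\<forall>\<^sub>F N in sequentially.
        norm (pabs (qsum (x + - of_nat (p ^ N)) n N - qsum x n N - 0)) \<le> 1 / \<rho> * \<rho> ^ N"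
      using \<rho> by (simp add: field_simps)
  qed
  from tendsto_addI[OF this L]
  have "(\<lambda>N. qsum (x + - of_nat (p ^ N)) n N) \<longlonglongrightarrow> L" by simp
  from tendsto_multI[OF tendsto_const this]
  have "(\<lambda>N. (- q) ^ n * qsum (x + - of_nat (p ^ N)) n N) \<longlonglongrightarrow> (- q) ^ n * L" .
  then have "q_integral p (1 / q) (\<lambda>x1. qnum (1 / q) (1 - x + x1) ^ n) = (- q) ^ n * L"
    unfolding q_integral_def atLeast0LessThan qsum_reflect[OF \<open>x \<in> Zp\<close>] by (rule limI)
  moreover have "q_integral p q (\<lambda>x1. qnum q (x + x1) ^ n) = L"
    unfolding q_integral_def atLeast0LessThan L_def qsum_def ..
  ultimately show ?thesis by (simp only: power_mult_distrib[symmetric]) simp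
qed

end
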